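(* Let $A\in\mathbf{rGr}^{\bullet}$. If $A$ is perfect and $\mathsf{wStab}(A)=0$ (i.e. $\mathsf{wStab}(A)=\{0\}$), then $A$ has representable action in $\mathbf{rGr}^{\bullet}$ and $\mathbb{AR}(A)=\mathsf{Pentact}(A)$; that is, $\mathsf{Pentact}(A)$, with its action on $A$ given by $\mathbf{b}\cdot a=b\cdot a$, $a^{\mathbf{b}}=a^{b}$, $\mathbf{b}^{a}=b^{a}$, is an action representer of $A$.
   Context: **Reduced groups with action.** A group with action is a group $G$ (written additively, not assumed commutative) with a map $G\times G\to G$, $(g,h)\mapsto g^{h}$, such that $(g+g')^{h}=g^{h}+g'^{h}$, $g^{h+h'}=(g^{h})^{h'}$, $g^{0}=g$ for all $g,g',h,h'\in G$. Morphisms are group homomorphisms $\alpha$ with $\alpha(g^{h})=\alpha(g)^{\alpha(h)}$. The category $\mathbf{rGr}^{\bullet}$ of reduced groups with action is the full subcategory of those $G$ such that for all $x,y,z\in G$: $x^{y}+z=z+x^{y}$ whenever $y\neq 0$, and $x^{(y^{z})}=x^{y}$. **Derived actions.** Let $A,B\in\mathbf{rGr}^{\bullet}$. A split extension of $B$ by $A$ is a sequence $0\to A\xrightarrow{i}E\xrightarrow{p}B\to0$ in $\mathbf{rGr}^{\bullet}$ with $p$ surjective and $i$ the kernel of $p$, together with a morphism $j\colon B\to E$ in $\mathbf{rGr}^{\bullet}$ with $pj=1_B$; $i(a)$ is identified with $a$. It induces a triple of functions $B\times A\to A$: $b\cdot a=j(b)+a-j(b)$, $\ b^{a}=j(b)^{a}-j(b)$,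 $\ a^{b}=a^{j(b)}$. A triple of functions $B\times A\to A$ (denoted $b\cdot a$, $b^{a}$, $a^{b}$) is a derived action of $B$ on $A$ in $\mathbf{rGr}^{\bullet}$ if it arises in this way from a split extension of $B$ by $A$. **Representable action.** $A\in\mathbf{rGr}^{\bullet}$ has representable action (is action representable) if there is an object $R\in\mathbf{rGr}^{\bullet}$ with a derived action on $A$ such that for any $B\in\mathbf{rGr}^{\bullet}$ with a derived action on $A$ there is a unique homomorphism $\varphi\colon B\to R$ in $\mathbf{rGr}^{\bullet}$ with $b\cdot a=\varphi(b)\cdot a$, $b^{a}=\varphi(b)^{a}$, $a^{b}=a^{\varphi(b)}$ for all $b\in B$, $a\in A$ (on the right-hand sides the action is that of $R$ on $A$). Such an $R$, unique up to isomorphism, is called the action representer of $A$ and denoted $\mathbb{AR}(A)$. **Perfect.** $A\in\mathbf{rGr}^{\bullet}$ is perfect if $A^{A}=A$, where $A^{A}$ is the subobject of $A$ (subgroup closed under the action operation) generated by the elements $a^{a'}$, $a,a'\in A$. **Pentactions.** Let $A\in\mathbf{rGr}^{\bullet}$. Consider a quintuple $\mathbf{b}$ of functions $A\to A$ whose values at $a\in A$ are denoted respectively $b\cdot a,\ a\cdot b,\ a^{b},\ {}^{b}a,\ b^{a}$ (here $b$ is only a symbol indexing the quintuple). For $x,a\in A$ put ${}^{x}a:=a^{-x}$. The quintuple $\mathbf{b}$ is a pentaction of $A$ if for all $a,a'\in A$: 1. $b\cdot(a+a')=b\cdot a+b\cdot a'$; 1°. $(a+a')\cdot b=a\cdot b+a'\cdot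 b$; 2. $(a+a')^{b}=a^{b}+a'^{b}$; 2°. ${}^{b}(a+a')={}^{b}a+{}^{b}a'$; 3. $(b\cdot a)^{a'}=a^{a'}$ if $a'\neq0$; 3°. $(a\cdot b)^{a'}=a^{a'}$ if $a'\ne 0$; 4. $b^{(a+a')}=(b^{a})^{a'}+b^{a'}$; 5. $(a^{b\cdot a'})^{b}=(a^{b})^{a'}$; 5°. ${}^{b}({}^{a'\cdot b}a)={}^{a'}({}^{b}a)$; 6. $b\cdot a^{a'}=a^{a'}$ if $a'\neq 0$; 6°. $a^{a'}\cdot b=a^{a'}$ if $a'\ne0$; 7. $b^{(a^{a'})}=b^{a}$; 8. $a^{b}+a'=a'+a^{b}$ for all $a,a'$, provided $x^{b}\neq x$ for at least one $x\in A$; 8°. ${}^{b}a+a'=a'+{}^{b}a$ for all $a,a'$, provided ${}^{b}x\neq x$ for at least one $x\in A$; 9. $a^{(a'^{b})}=a^{a'}$; 9°. $a^{({}^{b}a')}=a^{a'}$; 10. $a^{(b^{a'})}=a$ if $a'\neq0$; 11. $(b\cdot a)\cdot b=b\cdot(a\cdot b)=a$; 12. ${}^{b}(a^{b})=({}^{b}a)^{b}=a$. $\mathsf{Pentact}(A)$ is the set of all pentactions of $A$. **Operations.** $\mathsf{Pentact}(A)$ is considered with the following addition and action operation. For pentactions $\mathbf{b},\mathbf{b}'$ of $A$ the quintuple $\mathbf{b}+\mathbf{b}'$ is defined by $(b+b')\cdot a=b\cdot(b'\cdot a)$, $a\cdot(b+b')=(a\cdot b)\cdot b'$, $a^{(b+b')}=(a^{b})^{b'}$,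 ${}^{(b+b')}a={}^{b}({}^{b'}a)$, $(b+b')^{a}=b^{a}+b\cdot(b'^{a})$; and the quintuple $\mathbf{b}^{\mathbf{b}'}$ is defined by $(b^{b'})\cdot a=a$, $a\cdot(b^{b'})=a$, $a^{(b^{b'})}=a^{b}$, ${}^{(b^{b'})}a={}^{b}a$, $(b^{b'})^{a}=(b^{(b'\cdot a)})^{b'}$. The zero pentaction $\mathbf{0}$ is given by $0\cdot a=a\cdot 0=a^{0}={}^{0}a=a$, $0^{a}=0$. **Weak stabilizer.** $\mathsf{wStab}(A)$ is the set of all elements of $A$ of the forms $b^{(b'^{a})}$, $\ b^{(a^{b'})}-b^{a}$, $\ a^{b+b'}-a^{b'+b}$, where $a\in A$ and $\mathbf{b},\mathbf{b}'\in\mathsf{Pentact}(A)$. *)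

theory Defs
  imports "HOL-Algebra.Coset"
begin

section \<open>Reduced groups with action\<close>

text \<open>The additive (not necessarily commutative) groups of the source are HOL-Algebra groups, so
  \<open>x + y\<close>, \<open>0\<close>, \<open>- x\<close> are rendered \<open>x \<otimes> y\<close>, \<open>\<one>\<close>, \<open>inv x\<close>; the action operation \<open>g\<^sup>h\<close> is
  rendered \<open>g \<triangleleft> h\<close>.\<close>

record 'a gract = "'a monoid" +
  act :: "'a \<Rightarrow> 'a \<Rightarrow> 'a"  (infixl "\<triangleleft>\<index>" 80)

locale group_with_action = group G for G (structure) +
  assumes act_closed: "\<lbrakk>g \<in> carrier G; h \<in> carrier G\<rbrakk> \<Longrightarrow> g \<triangleleft> h \<in> carrier G"
    and act_mult: "\<lbrakk>g \<in> carrier G; g' \<in> carrier G; h \<in> carrier G\<rbrakk>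
      \<Longrightarrow> (g \<otimes> g') \<triangleleft> h = (g \<triangleleft> h) \<otimes> (g' \<triangleleft> h)"
    and act_act: "\<lbrakk>g \<in> carrier G; h \<in> carrier G; h' \<in> carrier G\<rbrakk>
      \<Longrightarrow> g \<triangleleft> (h \<otimes> h') = (g \<triangleleft> h) \<triangleleft> h'"
    and act_one: "g \<in> carrier G \<Longrightarrow> g \<triangleleft> \<one> = g"

locale reduced_group_with_action = group_with_action G for G (structure) +
  assumes act_commute: "\<lbrakk>x \<in> carrier G; y \<in> carrier G; z \<in> carrier G; y \<noteq> \<one>\<rbrakk>
      \<Longrightarrow> (x \<triangleleft> y) \<otimes> z = z \<otimes> (x \<triangleleft> y)"
    and act_reduced: "\<lbrakk>x \<in> carrier G; y \<in> carrier G; z \<in> carrier G\<rbrakk>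
      \<Longrightarrow> x \<triangleleft> (y \<triangleleft> z) = x \<triangleleft> y"

definition act_hom ::
    "('a, 'm) gract_scheme \<Rightarrow> ('b, 'n) gract_scheme \<Rightarrow> ('a \<Rightarrow> 'b) set" where
  "act_hom G H = {\<alpha> \<in> hom G H. \<forall>g\<in>carrier G. \<forall>h\<in>carrier G.
     \<alpha> (g \<triangleleft>\<^bsub>G\<^esub> h) = \<alpha> g \<triangleleft>\<^bsub>H\<^esub> \<alpha> h}"

definition subobject :: "'a set \<Rightarrow> ('a, 'm) gract_scheme \<Rightarrow> bool" where
  "subobject H G \<longleftrightarrow> subgroup H G \<and> (\<forall>x\<in>H. \<forall>y\<in>H. x \<triangleleft>\<^bsub>G\<^esub> y \<in> H)"

definition generated_subobject :: "('a, 'm) gract_scheme \<Rightarrow> 'a set \<Rightarrow> 'a set" where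
  "generated_subobject G S = \<Inter>{H. subobject H G \<and> S \<subseteq> H}"

definition perfect :: "('a, 'm) gract_scheme \<Rightarrow> bool" where
  "perfect A \<longleftrightarrow>
     generated_subobject A {a \<triangleleft>\<^bsub>A\<^esub> a' |a a'. a \<in> carrier A \<and> a' \<in> carrier A} = carrier A"


section \<open>Split extensions and derived actions\<close>

definition split_extension ::
    "('a, 'm) gract_scheme \<Rightarrow> ('b, 'n) gract_scheme \<Rightarrow> ('e, 'k) gract_scheme
      \<Rightarrow> ('a \<Rightarrow> 'e) \<Rightarrow> ('e \<Rightarrow> 'b) \<Rightarrow> ('b \<Rightarrow> 'e) \<Rightarrow> bool" where
  "split_extension A B E i p j \<longleftrightarrow>
     reduced_group_with_action A \<and> reduced_group_with_action B \<and> reduced_group_with_action E \<and>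
     i \<in> act_hom A E \<and> inj_on i (carrier A) \<and> i ` carrier A = kernel E B p \<and>
     p \<in> act_hom E B \<and> p ` carrier E = carrier B \<and>
     j \<in> act_hom B E \<and> (\<forall>b\<in>carrier B. p (j b) = b)"

text \<open>A triple of functions \<open>B \<times> A \<rightarrow> A\<close> is written \<open>dot b a = b \<cdot> a\<close>, \<open>lexp b a = b\<^sup>a\<close>,
  \<open>rexp b a = a\<^sup>b\<close>. The identification of \<open>a\<close> with \<open>i a\<close> is made explicit.\<close>

definition induces_action ::
    "('a, 'm) gract_scheme \<Rightarrow> ('b, 'n) gract_scheme \<Rightarrow> ('e, 'k) gract_scheme
      \<Rightarrow> ('a \<Rightarrow> 'e) \<Rightarrow> ('b \<Rightarrow> 'e)
      \<Rightarrow> ('b \<Rightarrow> 'a \<Rightarrow> 'a) \<Rightarrow> ('b \<Rightarrow> 'a \<Rightarrow> 'a) \<Rightarrow> ('b \<Rightarrow> 'a \<Rightarrow> 'a) \<Rightarrow> bool" where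
  "induces_action A B E i j dot lexp rexp \<longleftrightarrow>
     (\<forall>b\<in>carrier B. \<forall>a\<in>carrier A.
        dot b a \<in> carrier A \<and> lexp b a \<in> carrier A \<and> rexp b a \<in> carrier A \<and>
        i (dot b a) = j b \<otimes>\<^bsub>E\<^esub> i a \<otimes>\<^bsub>E\<^esub> inv\<^bsub>E\<^esub> (j b) \<and>
        i (lexp b a) = (j b \<triangleleft>\<^bsub>E\<^esub> i a) \<otimes>\<^bsub>E\<^esub> inv\<^bsub>E\<^esub> (j b) \<and>
        i (rexp b a) = i a \<triangleleft>\<^bsub>E\<^esub> j b)"

text \<open>HOL cannot quantify over the type of the elements of \<open>E\<close>. Every element of a split extension
  is \<open>i a + j b\<close> for unique \<open>a\<close>, \<open>b\<close>, so extensions on the type \<open>'a \<times> 'b\<close> suffice; this is the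
  lemma \<open>derived_action_if_split_extension\<close> below.\<close>

definition derived_action ::
    "('a, 'm) gract_scheme \<Rightarrow> ('b, 'n) gract_scheme
      \<Rightarrow> ('b \<Rightarrow> 'a \<Rightarrow> 'a) \<Rightarrow> ('b \<Rightarrow> 'a \<Rightarrow> 'a) \<Rightarrow> ('b \<Rightarrow> 'a \<Rightarrow> 'a) \<Rightarrow> bool" where
  "derived_action A B dot lexp rexp \<longleftrightarrow>
     (\<exists>(E :: ('a \<times> 'b) gract) i p j.
        split_extension A B E i p j \<and> induces_action A B E i j dot lexp rexp)"

context
  fixes E :: "('e, 'k) gract_scheme" and X :: "'x set" and g :: "'x \<Rightarrow> 'e"
    and h :: "'e \<Rightarrow> 'x" and E' :: "'x gract"
  assumes E: "reduced_group_with_action E"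
    and g: "\<And>x. x \<in> X \<Longrightarrow> g x \<in> carrier E" "\<And>x. x \<in> X \<Longrightarrow> h (g x) = x"
    and h: "\<And>e. e \<in> carrier E \<Longrightarrow> h e \<in> X" "\<And>e. e \<in> carrier E \<Longrightarrow> g (h e) = e"
    and E': "E' = \<lparr>carrier = X, mult = \<lambda>x y. h (g x \<otimes>\<^bsub>E\<^esub> g y), one = h \<one>\<^bsub>E\<^esub>,
                   act = \<lambda>x y. h (g x \<triangleleft>\<^bsub>E\<^esub> g y)\<rparr>"
begin

interpretation E: reduced_group_with_action E by (fact E)

lemma transport_reduced: "reduced_group_with_action E'"
proof -
  have gr: "group E'"
  proof (rule groupI)
    fix x assume "x \<in> carrier E'"
    then have "h (inv\<^bsub>E\<^esub> (g x)) \<in> carrier E'" "h (inv\<^bsub>E\<^esub> (g x)) \<otimes>\<^bsub>E'\<^esub> x = \<one>\<^bsub>E'\<^esub>"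
      by (auto simp: E' g h)
    then show "\<exists>y\<in>carrier E'. y \<otimes>\<^bsub>E'\<^esub> x = \<one>\<^bsub>E'\<^esub>" by blast
  qed (auto simp: E' g h E.m_assoc)
  have eq: "y = \<one>\<^bsub>E'\<^esub>" if "y \<in> X" "g y = \<one>\<^bsub>E\<^esub>" for y
    using g(2)[OF that(1)] that(2) by (simp add: E')
  show ?thesis
    unfolding reduced_group_with_action_def group_with_action_def group_with_action_axioms_def
      reduced_group_with_action_axioms_def
    using gr eq
    by (auto simp: E' g h E.act_closed E.act_mult E.act_act E.act_one E.act_reduced
        intro!: arg_cong[of _ _ h] E.act_commute)
qed

lemma transport_hom: "h \<in> act_hom E E'" "g \<in> act_hom E' E"
  by (auto simp: act_hom_def hom_def E' g h E.act_closed)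

lemma transport_inv: "e \<in> carrier E \<Longrightarrow> h (inv\<^bsub>E\<^esub> e) = inv\<^bsub>E'\<^esub> (h e)"
proof -
  assume e: "e \<in> carrier E"
  interpret E': reduced_group_with_action E' by (rule transport_reduced)
  interpret group_hom E E' h
    using transport_hom by unfold_locales (auto simp: act_hom_def)
  show ?thesis using e by simp
qed

end

lemma act_hom_comp: "\<lbrakk>f \<in> act_hom G H; f' \<in> act_hom H K\<rbrakk> \<Longrightarrow> f' \<circ> f \<in> act_hom G K"
  by (auto simp: act_hom_def hom_def Pi_iff)

lemma derived_action_if_split_extension:
  fixes A :: "('a, 'm) gract_scheme" and B :: "('b, 'n) gract_scheme"
    and E :: "('e, 'k) gract_scheme"
  assumes se: "split_extension A B E i p j"
    and ind: "induces_action A B E i j dot lexp rexp"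
  shows "derived_action A B dot lexp rexp"
proof -
  note se' = se[unfolded split_extension_def]
  interpret A: reduced_group_with_action A using se' by blast
  interpret B: reduced_group_with_action B using se' by blast
  interpret E: reduced_group_with_action E using se' by blast
  interpret p: group_hom E B p using se' by unfold_locales (auto simp: act_hom_def)
  interpret i: group_hom A E i using se' by unfold_locales (auto simp: act_hom_def)
  interpret j: group_hom B E j using se' by unfold_locales (auto simp: act_hom_def)
  have pj: "p (j b) = b" if "b \<in> carrier B" for b using se' that by blast
  have pi1: "p (i a) = \<one>\<^bsub>B\<^esub>" if "a \<in> carrier A" for a
    using se' that by (auto simp: kernel_def)
  have inji: "inj_on i (carrier A)" using se' by blast
  define X where "X = carrier A \<times> carrier B"
  define g where "g = (\<lambda>(a, b). i a \<otimes>\<^bsub>E\<^esub> j b)"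
  define h where "h = (\<lambda>e. (inv_into (carrier A) i (e \<otimes>\<^bsub>E\<^esub> inv\<^bsub>E\<^esub> (j (p e))), p e))"
  define E' where "E' = \<lparr>carrier = X, mult = \<lambda>x y. h (g x \<otimes>\<^bsub>E\<^esub> g y), one = h \<one>\<^bsub>E\<^esub>,
                   act = \<lambda>x y. h (g x \<triangleleft>\<^bsub>E\<^esub> g y)\<rparr>"
  have g1: "g x \<in> carrier E" if "x \<in> X" for x using that by (auto simp: X_def g_def)
  have g2: "h (g x) = x" if "x \<in> X" for x
    using that inji by (auto simp: X_def g_def h_def pi1 pj E.m_assoc)
  have ker: "e \<otimes>\<^bsub>E\<^esub> inv\<^bsub>E\<^esub> (j (p e)) \<in> i ` carrier A" if "e \<in> carrier E" for e
  proof -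
    have "e \<otimes>\<^bsub>E\<^esub> inv\<^bsub>E\<^esub> (j (p e)) \<in> kernel E B p"
      using that by (simp add: kernel_def pj)
    then show ?thesis using se' by simp
  qed
  have h1: "h e \<in> X" if "e \<in> carrier E" for e
    using that ker[OF that] by (auto simp: h_def X_def intro!: inv_into_into)
  have h2: "g (h e) = e" if "e \<in> carrier E" for e
    using that ker[OF that] by (auto simp: h_def g_def f_inv_into_f E.m_assoc)
  note tr = E.reduced_group_with_action_axioms g1 g2 h1 h2 E'_def
  have red: "reduced_group_with_action E'" by (rule transport_reduced[where g = g and h = h, OF tr])
  have hh: "h \<in> act_hom E E'" and hg: "g \<in> act_hom E' E" 
    using transport_hom[where g = g and h = h, OF tr] by blast+
  have hinv: "h (inv\<^bsub>E\<^esub> e) = inv\<^bsub>E'\<^esub> (h e)" if "e \<in> carrier E" for e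
    by (rule transport_inv[where g = g and h = h, OF tr that])
  have hmult: "h (x \<otimes>\<^bsub>E\<^esub> y) = h x \<otimes>\<^bsub>E'\<^esub> h y" "h (x \<triangleleft>\<^bsub>E\<^esub> y) = h x \<triangleleft>\<^bsub>E'\<^esub> h y"
    if "x \<in> carrier E" "y \<in> carrier E" for x y
    using hh that by (auto simp: act_hom_def hom_def)
  have cE': "carrier E' = X" by (simp add: E'_def)
  have himg: "h ` carrier E = X" using h1 g1 g2 by (auto intro!: image_eqI[where x = "g _"])
  have "split_extension A B E' (h \<circ> i) (p \<circ> g) (h \<circ> j)"
    unfolding split_extension_def
  proof (intro conjI)
    show "inj_on (h \<circ> i) (carrier A)"
      using inji h2 by (auto simp: inj_on_def) (metis i.hom_closed)
    have "kernel E' B (p \<circ> g) = h ` kernel E B p"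
      using g1 g2 h1 h2 by (auto simp: kernel_def cE' intro!: image_eqI[where x = "g _"])
    then show "(h \<circ> i) ` carrier A = kernel E' B (p \<circ> g)"
      using se' by (metis image_comp)
    show "(p \<circ> g) ` carrier E' = carrier B"
    proof -
      have "g ` X = carrier E" using h1 h2 g1 by (auto intro!: image_eqI[where x = "h _"])
      then show ?thesis using se' by (metis image_comp cE')
    qed
    show "\<forall>b\<in>carrier B. (p \<circ> g) ((h \<circ> j) b) = b" by (simp add: h2 pj)
  qed (use se' red hh hg in \<open>blast intro: act_hom_comp\<close>)+
  moreover have "induces_action A B E' (h \<circ> i) (h \<circ> j) dot lexp rexp"
    using ind by (auto simp: induces_action_def hmult hinv E.act_closed)
  ultimately show ?thesis unfolding derived_action_def by blast
qed


section \<open>Representable actions\<close>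

text \<open>\<open>R\<close> with the given triple is an action representer of \<open>A\<close>, tested against the objects \<open>B\<close>
  carried by the type \<open>'b\<close>. The type argument lets a theorem with \<open>'b\<close> free assert the property for
  all \<open>B\<close>. Uniqueness of \<open>\<phi>\<close> is uniqueness on \<open>carrier B\<close>, whence \<open>extensional\<close>.\<close>

definition action_representer ::
    "'b itself \<Rightarrow> ('a, 'm) gract_scheme \<Rightarrow> ('r, 'n) gract_scheme
      \<Rightarrow> ('r \<Rightarrow> 'a \<Rightarrow> 'a) \<Rightarrow> ('r \<Rightarrow> 'a \<Rightarrow> 'a) \<Rightarrow> ('r \<Rightarrow> 'a \<Rightarrow> 'a) \<Rightarrow> bool" where
  "action_representer (TB :: 'b itself) A R dotR lexpR rexpR \<longleftrightarrow>
     reduced_group_with_action R \<and> derived_action A R dotR lexpR rexpR \<and>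
     (\<forall>(B :: 'b gract) dot lexp rexp.
        reduced_group_with_action B \<longrightarrow> derived_action A B dot lexp rexp \<longrightarrow>
        (\<exists>!\<phi>. \<phi> \<in> act_hom B R \<and> \<phi> \<in> extensional (carrier B) \<and>
           (\<forall>b\<in>carrier B. \<forall>a\<in>carrier A.
              dot b a = dotR (\<phi> b) a \<and> lexp b a = lexpR (\<phi> b) a \<and> rexp b a = rexpR (\<phi> b) a)))"

text \<open>Here \<open>'r\<close> is the type carrying the representer.\<close>

definition has_representable_action ::
    "'r itself \<Rightarrow> 'b itself \<Rightarrow> ('a, 'm) gract_scheme \<Rightarrow> bool" where
  "has_representable_action (TR :: 'r itself) (TB :: 'b itself) A \<longleftrightarrow>
     (\<exists>(R :: 'r gract) dotR lexpR rexpR. action_representer TB A R dotR lexpR rexpR)"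


section \<open>Pentactions\<close>

text \<open>The fields are \<open>b \<cdot> a\<close>, \<open>a \<cdot> b\<close>, \<open>a\<^sup>b\<close>, the left power (\<open>b\<close> to the upper left of \<open>a\<close>), and
  \<open>b\<^sup>a\<close>, in this order; in every field the pentaction comes first.\<close>

record 'a quintuple =
  ldot :: "'a \<Rightarrow> 'a"
  rdot :: "'a \<Rightarrow> 'a"
  rpow :: "'a \<Rightarrow> 'a"
  lpow :: "'a \<Rightarrow> 'a"
  bpow :: "'a \<Rightarrow> 'a"

text \<open>The clauses are listed in the order 1, 1', 2, 2', 3, 3', 4, 5, 5', 6, 6', 7, 8, 8', 9, 9',
  10, 11, 12, where the prime stands for the degree sign of the source. In 5' the left powers by
  elements \<open>x\<close> of \<open>A\<close> are the powers by \<open>- x\<close>. The functions are taken extensional, so that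
  pentactions agreeing on \<open>carrier A\<close> are equal.\<close>

definition pentaction :: "('a, 'm) gract_scheme \<Rightarrow> 'a quintuple \<Rightarrow> bool" where
  "pentaction A b \<longleftrightarrow>
     ldot b \<in> carrier A \<rightarrow>\<^sub>E carrier A \<and> rdot b \<in> carrier A \<rightarrow>\<^sub>E carrier A \<and>
     rpow b \<in> carrier A \<rightarrow>\<^sub>E carrier A \<and> lpow b \<in> carrier A \<rightarrow>\<^sub>E carrier A \<and>
     bpow b \<in> carrier A \<rightarrow>\<^sub>E carrier A \<and>
     (\<forall>a\<in>carrier A. \<forall>a'\<in>carrier A.
        ldot b (a \<otimes>\<^bsub>A\<^esub> a') = ldot b a \<otimes>\<^bsub>A\<^esub> ldot b a' \<and>
        rdot b (a \<otimes>\<^bsub>A\<^esub> a') = rdot b a \<otimes>\<^bsub>A\<^esub> rdot b a' \<and>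
        rpow b (a \<otimes>\<^bsub>A\<^esub> a') = rpow b a \<otimes>\<^bsub>A\<^esub> rpow b a' \<and>
        lpow b (a \<otimes>\<^bsub>A\<^esub> a') = lpow b a \<otimes>\<^bsub>A\<^esub> lpow b a' \<and>
        (a' \<noteq> \<one>\<^bsub>A\<^esub> \<longrightarrow> ldot b a \<triangleleft>\<^bsub>A\<^esub> a' = a \<triangleleft>\<^bsub>A\<^esub> a') \<and>
        (a' \<noteq> \<one>\<^bsub>A\<^esub> \<longrightarrow> rdot b a \<triangleleft>\<^bsub>A\<^esub> a' = a \<triangleleft>\<^bsub>A\<^esub> a') \<and>
        bpow b (a \<otimes>\<^bsub>A\<^esub> a') = (bpow b a \<triangleleft>\<^bsub>A\<^esub> a') \<otimes>\<^bsub>A\<^esub> bpow b a' \<and>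
        rpow b (a \<triangleleft>\<^bsub>A\<^esub> ldot b a') = rpow b a \<triangleleft>\<^bsub>A\<^esub> a' \<and>
        lpow b (a \<triangleleft>\<^bsub>A\<^esub> (inv\<^bsub>A\<^esub> (rdot b a'))) = lpow b a \<triangleleft>\<^bsub>A\<^esub> (inv\<^bsub>A\<^esub> a') \<and>
        (a' \<noteq> \<one>\<^bsub>A\<^esub> \<longrightarrow> ldot b (a \<triangleleft>\<^bsub>A\<^esub> a') = a \<triangleleft>\<^bsub>A\<^esub> a') \<and>
        (a' \<noteq> \<one>\<^bsub>A\<^esub> \<longrightarrow> rdot b (a \<triangleleft>\<^bsub>A\<^esub> a') = a \<triangleleft>\<^bsub>A\<^esub> a') \<and>
        bpow b (a \<triangleleft>\<^bsub>A\<^esub> a') = bpow b a \<and>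
        ((\<exists>x\<in>carrier A. rpow b x \<noteq> x) \<longrightarrow> rpow b a \<otimes>\<^bsub>A\<^esub> a' = a' \<otimes>\<^bsub>A\<^esub> rpow b a) \<and>
        ((\<exists>x\<in>carrier A. lpow b x \<noteq> x) \<longrightarrow> lpow b a \<otimes>\<^bsub>A\<^esub> a' = a' \<otimes>\<^bsub>A\<^esub> lpow b a) \<and>
        a \<triangleleft>\<^bsub>A\<^esub> rpow b a' = a \<triangleleft>\<^bsub>A\<^esub> a' \<and>
        a \<triangleleft>\<^bsub>A\<^esub> lpow b a' = a \<triangleleft>\<^bsub>A\<^esub> a' \<and>
        (a' \<noteq> \<one>\<^bsub>A\<^esub> \<longrightarrow> a \<triangleleft>\<^bsub>A\<^esub> bpow b a' = a) \<and>
        rdot b (ldot b a) = a \<and> ldot b (rdot b a) = a \<and>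
        lpow b (rpow b a) = a \<and> rpow b (lpow b a) = a)"

definition quint_add ::
    "('a, 'm) gract_scheme \<Rightarrow> 'a quintuple \<Rightarrow> 'a quintuple \<Rightarrow> 'a quintuple" where
  "quint_add A b b' =
     \<lparr>ldot = \<lambda>a\<in>carrier A. ldot b (ldot b' a),
      rdot = \<lambda>a\<in>carrier A. rdot b' (rdot b a),
      rpow = \<lambda>a\<in>carrier A. rpow b' (rpow b a),
      lpow = \<lambda>a\<in>carrier A. lpow b (lpow b' a),
      bpow = \<lambda>a\<in>carrier A. bpow b a \<otimes>\<^bsub>A\<^esub> ldot b (bpow b' a)\<rparr>"

definition quint_act ::
    "('a, 'm) gract_scheme \<Rightarrow> 'a quintuple \<Rightarrow> 'a quintuple \<Rightarrow> 'a quintuple" where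
  "quint_act A b b' =
     \<lparr>ldot = \<lambda>a\<in>carrier A. a,
      rdot = \<lambda>a\<in>carrier A. a,
      rpow = \<lambda>a\<in>carrier A. rpow b a,
      lpow = \<lambda>a\<in>carrier A. lpow b a,
      bpow = \<lambda>a\<in>carrier A. rpow b' (bpow b (ldot b' a))\<rparr>"

definition quint_zero :: "('a, 'm) gract_scheme \<Rightarrow> 'a quintuple" where
  "quint_zero A =
     \<lparr>ldot = \<lambda>a\<in>carrier A. a,
      rdot = \<lambda>a\<in>carrier A. a,
      rpow = \<lambda>a\<in>carrier A. a,
      lpow = \<lambda>a\<in>carrier A. a,
      bpow = \<lambda>a\<in>carrier A. \<one>\<^bsub>A\<^esub>\<rparr>"

definition Pentact :: "('a, 'm) gract_scheme \<Rightarrow> 'a quintuple gract" where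
  "Pentact A =
     \<lparr>carrier = {b. pentaction A b}, mult = quint_add A, one = quint_zero A,
      act = quint_act A\<rparr>"

definition wStab :: "('a, 'm) gract_scheme \<Rightarrow> 'a set" where
  "wStab A =
     {bpow b (bpow b' a) |a b b'. a \<in> carrier A \<and> pentaction A b \<and> pentaction A b'} \<union>
     {bpow b (rpow b' a) \<otimes>\<^bsub>A\<^esub> inv\<^bsub>A\<^esub> (bpow b a) |a b b'.
        a \<in> carrier A \<and> pentaction A b \<and> pentaction A b'} \<union>
     {rpow (quint_add A b b') a \<otimes>\<^bsub>A\<^esub> inv\<^bsub>A\<^esub> (rpow (quint_add A b' b) a) |a b b'.
        a \<in> carrier A \<and> pentaction A b \<and> pentaction A b'}"

end

theory Submission
  imports Defs
begin

text \<open>Each map \<open>g \<mapsto> g \<triangleleft> h\<close> is bijective with inverse \<open>g \<mapsto> g \<triangleleft> inv h\<close>. Hence an element \<open>h \<noteq> \<one>\<close>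
  makes every element of a reduced group with action a value \<open>g \<triangleleft> h\<close>, and all such values are
  central: reduced groups with action are commutative. For the same reason clauses 6 and 6' force
  both dot operations of a pentaction to be the identity. A pentaction is then an automorphism
  \<open>rpow\<close> together with a crossed homomorphism \<open>bpow\<close>, and \<open>wStab A = {\<one>}\<close> supplies exactly the
  identities making \<open>Pentact A\<close> commutative and the semidirect product of \<open>A\<close> and \<open>Pentact A\<close>
  reduced.\<close>

section \<open>Commutativity\<close>

lemma (in group_with_action) act_inv_act:
  "\<lbrakk>g \<in> carrier G; h \<in> carrier G\<rbrakk> \<Longrightarrow> (g \<triangleleft> (inv h)) \<triangleleft> h = g"
  by (metis act_act act_one inv_closed l_inv)

lemma (in group_with_action) act_act_inv:
  "\<lbrakk>g \<in> carrier G; h \<in> carrier G\<rbrakk> \<Longrightarrow> (g \<triangleleft> h) \<triangleleft> (inv h) = g"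
  by (metis act_act act_one inv_closed r_inv)

lemma (in group_with_action) act_group_hom:
  "h \<in> carrier G \<Longrightarrow> group_hom G G (\<lambda>g. g \<triangleleft> h)"
  by unfold_locales (auto simp: hom_def act_closed act_mult)

lemma (in group_with_action) one_act: "h \<in> carrier G \<Longrightarrow> \<one> \<triangleleft> h = \<one>"
  using group_hom.hom_one[OF act_group_hom] by simp

lemma (in group_with_action) inv_act:
  "\<lbrakk>g \<in> carrier G; h \<in> carrier G\<rbrakk> \<Longrightarrow> inv g \<triangleleft> h = inv (g \<triangleleft> h)"
  using group_hom.hom_inv[OF act_group_hom] by simp

sublocale reduced_group_with_action \<subseteq> comm_group G
proof (rule comm_groupI)
  fix x y assume x: "x \<in> carrier G" and y: "y \<in> carrier G"
  show "x \<otimes> y = y \<otimes> x"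
  proof (cases "y = \<one>")
    case False
    then show ?thesis
      using act_commute[of "x \<triangleleft> (inv y)" y y] x y by (simp add: act_closed act_inv_act)
  qed (use x in simp)
qed (auto simp: m_assoc intro: l_inv_ex)


section \<open>Pentactions\<close>

lemma pentaction_PiE:
  assumes "pentaction A b"
  shows "ldot b \<in> carrier A \<rightarrow>\<^sub>E carrier A" "rdot b \<in> carrier A \<rightarrow>\<^sub>E carrier A"
    "rpow b \<in> carrier A \<rightarrow>\<^sub>E carrier A" "lpow b \<in> carrier A \<rightarrow>\<^sub>E carrier A"
    "bpow b \<in> carrier A \<rightarrow>\<^sub>E carrier A"
  by (insert assms, unfold pentaction_def) (elim conjE, assumption)+

text \<open>Later proofs pick these facts by position: 1 and 2 are clauses 1 and 1', 5 is clause 4,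
  6 and 7 are clauses 5 and 5', 8 and 9 are clauses 6 and 6', 13 is clause 10. Side conditions stay
  as object implications so that each conjunct matches verbatim.\<close>

lemma pentaction_clauses:
  assumes "pentaction A b" "a \<in> carrier A" "a' \<in> carrier A"
  shows "ldot b (a \<otimes>\<^bsub>A\<^esub> a') = ldot b a \<otimes>\<^bsub>A\<^esub> ldot b a'"
    and "rdot b (a \<otimes>\<^bsub>A\<^esub> a') = rdot b a \<otimes>\<^bsub>A\<^esub> rdot b a'"
    and "rpow b (a \<otimes>\<^bsub>A\<^esub> a') = rpow b a \<otimes>\<^bsub>A\<^esub> rpow b a'"
    and "lpow b (a \<otimes>\<^bsub>A\<^esub> a') = lpow b a \<otimes>\<^bsub>A\<^esub> lpow b a'"
    and "bpow b (a \<otimes>\<^bsub>A\<^esub> a') = (bpow b a \<triangleleft>\<^bsub>A\<^esub> a') \<otimes>\<^bsub>A\<^esub> bpow b a'"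
    and "rpow b (a \<triangleleft>\<^bsub>A\<^esub> ldot b a') = rpow b a \<triangleleft>\<^bsub>A\<^esub> a'"
    and "lpow b (a \<triangleleft>\<^bsub>A\<^esub> (inv\<^bsub>A\<^esub> (rdot b a'))) = lpow b a \<triangleleft>\<^bsub>A\<^esub> (inv\<^bsub>A\<^esub> a')"
    and "a' \<noteq> \<one>\<^bsub>A\<^esub> \<longrightarrow> ldot b (a \<triangleleft>\<^bsub>A\<^esub> a') = a \<triangleleft>\<^bsub>A\<^esub> a'"
    and "a' \<noteq> \<one>\<^bsub>A\<^esub> \<longrightarrow> rdot b (a \<triangleleft>\<^bsub>A\<^esub> a') = a \<triangleleft>\<^bsub>A\<^esub> a'"
    and "bpow b (a \<triangleleft>\<^bsub>A\<^esub> a') = bpow b a"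
    and "a \<triangleleft>\<^bsub>A\<^esub> rpow b a' = a \<triangleleft>\<^bsub>A\<^esub> a'"
    and "a \<triangleleft>\<^bsub>A\<^esub> lpow b a' = a \<triangleleft>\<^bsub>A\<^esub> a'"
    and "a' \<noteq> \<one>\<^bsub>A\<^esub> \<longrightarrow> a \<triangleleft>\<^bsub>A\<^esub> bpow b a' = a"
    and "lpow b (rpow b a) = a" and "rpow b (lpow b a) = a"
  by (insert assms, unfold pentaction_def)
    (elim conjE, drule (1) bspec, drule (1) bspec, elim conjE, assumption)+

lemma pentaction_closed:
  assumes "pentaction A b" "a \<in> carrier A"
  shows "rpow b a \<in> carrier A" "lpow b a \<in> carrier A" "bpow b a \<in> carrier A"
  using pentaction_PiE(3-5)[OF assms(1)] assms(2) by (auto dest: PiE_mem)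

context reduced_group_with_action
begin

lemma pentaction_dots:
  assumes b: "pentaction G b"
  shows "ldot b = (\<lambda>a\<in>carrier G. a)" "rdot b = (\<lambda>a\<in>carrier G. a)"
proof -
  note PiE = pentaction_PiE(1,2)[OF b] and cl = PiE_mem[OF PiE(1)] PiE_mem[OF PiE(2)]
  have "ldot b a = a \<and> rdot b a = a" if a: "a \<in> carrier G" for a
  proof (cases "a = \<one>")
    case True
    \<comment> \<open>Additivity makes the image of \<open>\<one>\<close> an idempotent of the
      group, hence \<open>\<one>\<close>.\<close>
    then show ?thesis using pentaction_clauses(1,2)[OF b, of \<one> \<one>] cl by simp
  next
    case False
    \<comment> \<open>The exponent is \<open>a\<close> itself, the one element known to differ from
      \<open>\<one>\<close>: \<open>a\<close> is the power by \<open>a\<close> of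
      \<open>a \<triangleleft> (inv a)\<close>.\<close>
    then show ?thesis
      using pentaction_clauses(8,9)[OF b, of "a \<triangleleft> (inv a)" a] a by (simp add: act_inv_act act_closed)
  qed
  then show "ldot b = (\<lambda>a\<in>carrier G. a)" "rdot b = (\<lambda>a\<in>carrier G. a)"
    using PiE by (auto intro!: extensionalityI[of _ "carrier G"] simp: PiE_iff)
qed

text \<open>With identity dots, clauses 5 and 5' become commutation of \<open>rpow\<close> and
  \<open>lpow\<close> with powers by elements of the group, and clause 10 loses its side condition
  because \<open>bpow b \<one> = \<one>\<close>.\<close>

lemma pentaction_rules:
  assumes b: "pentaction G b" and a: "a \<in> carrier G" "a' \<in> carrier G"
  shows "rpow b (a \<otimes> a') = rpow b a \<otimes> rpow b a'"
    and "lpow b (a \<otimes> a') = lpow b a \<otimes> lpow b a'"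
    and "bpow b (a \<otimes> a') = (bpow b a \<triangleleft> a') \<otimes> bpow b a'"
    and "rpow b (a \<triangleleft> a') = rpow b a \<triangleleft> a'"
    and "lpow b (a \<triangleleft> a') = lpow b a \<triangleleft> a'"
    and "bpow b (a \<triangleleft> a') = bpow b a"
    and "a \<triangleleft> rpow b a' = a \<triangleleft> a'" and "a \<triangleleft> lpow b a' = a \<triangleleft> a'" and "a \<triangleleft> bpow b a' = a"
    and "lpow b (rpow b a) = a" and "rpow b (lpow b a) = a"
proof -
  show "a \<triangleleft> bpow b a' = a"
  proof (cases "a' = \<one>")
    case True
    have "bpow b \<one> = \<one>"
      using pentaction_clauses(5)[OF b, of \<one> \<one>] pentaction_closed(3)[OF b, of \<one>]
      by (simp add: act_one)
    then show ?thesis using True a by (simp add: act_one)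
  qed (use pentaction_clauses(13)[OF b a] in simp)
  \<comment> \<open>Clause 5' is stated with inverses, so it is applied to \<open>inv a'\<close> and
    the double inverse cancels.\<close>
  show "rpow b (a \<triangleleft> a') = rpow b a \<triangleleft> a'" "lpow b (a \<triangleleft> a') = lpow b a \<triangleleft> a'"
    using pentaction_clauses(6)[OF b a] pentaction_clauses(7)[OF b a(1), of "inv a'"] a
    by (simp_all add: pentaction_dots[OF b])
qed (rule pentaction_clauses[OF b a])+

text \<open>Converse of the previous reduction: identity dots settle the dot clauses, and
  commutativity of the group settles clauses 8 and 8'.\<close>

lemma pentactionI:
  assumes dots: "ldot b = (\<lambda>a\<in>carrier G. a)" "rdot b = (\<lambda>a\<in>carrier G. a)"
    and PiE: "rpow b \<in> carrier G \<rightarrow>\<^sub>E carrier G" "lpow b \<in> carrier G \<rightarrow>\<^sub>E carrier G"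
      "bpow b \<in> carrier G \<rightarrow>\<^sub>E carrier G"
    and rules: "\<And>a a'. \<lbrakk>a \<in> carrier G; a' \<in> carrier G\<rbrakk> \<Longrightarrow> rpow b (a \<otimes> a') = rpow b a \<otimes> rpow b a'"
      "\<And>a a'. \<lbrakk>a \<in> carrier G; a' \<in> carrier G\<rbrakk> \<Longrightarrow> lpow b (a \<otimes> a') = lpow b a \<otimes> lpow b a'"
      "\<And>a a'. \<lbrakk>a \<in> carrier G; a' \<in> carrier G\<rbrakk>
        \<Longrightarrow> bpow b (a \<otimes> a') = (bpow b a \<triangleleft> a') \<otimes> bpow b a'"
      "\<And>a a'. \<lbrakk>a \<in> carrier G; a' \<in> carrier G\<rbrakk> \<Longrightarrow> rpow b (a \<triangleleft> a') = rpow b a \<triangleleft> a'"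
      "\<And>a a'. \<lbrakk>a \<in> carrier G; a' \<in> carrier G\<rbrakk> \<Longrightarrow> lpow b (a \<triangleleft> a') = lpow b a \<triangleleft> a'"
      "\<And>a a'. \<lbrakk>a \<in> carrier G; a' \<in> carrier G\<rbrakk> \<Longrightarrow> bpow b (a \<triangleleft> a') = bpow b a"
      "\<And>a a'. \<lbrakk>a \<in> carrier G; a' \<in> carrier G\<rbrakk> \<Longrightarrow> a \<triangleleft> rpow b a' = a \<triangleleft> a'"
      "\<And>a a'. \<lbrakk>a \<in> carrier G; a' \<in> carrier G\<rbrakk> \<Longrightarrow> a \<triangleleft> lpow b a' = a \<triangleleft> a'"
      "\<And>a a'. \<lbrakk>a \<in> carrier G; a' \<in> carrier G\<rbrakk> \<Longrightarrow> a \<triangleleft> bpow b a' = a"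
      "\<And>a. a \<in> carrier G \<Longrightarrow> lpow b (rpow b a) = a"
      "\<And>a. a \<in> carrier G \<Longrightarrow> rpow b (lpow b a) = a"
  shows "pentaction G b"
  unfolding pentaction_def dots
  by (intro conjI ballI impI PiE; simp add: rules act_closed PiE_mem[OF PiE(1)] PiE_mem[OF PiE(2)] m_comm)

lemma pentaction_one:
  assumes "pentaction G b"
  shows "rpow b \<one> = \<one>" "bpow b \<one> = \<one>"
  using pentaction_rules(1,3)[OF assms, of \<one> \<one>] pentaction_closed[OF assms, of \<one>]
  by (auto simp: act_one)

text \<open>\<open>lpow\<close> need not be compared, since it is the inverse of \<open>rpow\<close>.\<close>

lemma pentaction_eqI:
  assumes b: "pentaction G b" and b': "pentaction G b'"
    and eq: "\<And>a. a \<in> carrier G \<Longrightarrow> rpow b a = rpow b' a"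
      "\<And>a. a \<in> carrier G \<Longrightarrow> bpow b a = bpow b' a"
  shows "b = b'"
proof (rule quintuple.equality)
  note PiE = pentaction_PiE[OF b] pentaction_PiE[OF b']
  show "rpow b = rpow b'" by (rule PiE_ext[OF PiE(3,8)]) (rule eq)
  show "bpow b = bpow b'" by (rule PiE_ext[OF PiE(5,10)]) (rule eq)
  have "lpow b a = lpow b' a" if a: "a \<in> carrier G" for a
  proof -
    \<comment> \<open>Uniqueness of inverses: by \<open>eq\<close>,
      \<open>rpow b (lpow b' a)\<close> is \<open>rpow b' (lpow b' a)\<close>, which is
      \<open>a\<close>.\<close>
    have "lpow b a = lpow b (rpow b (lpow b' a))"
      using a b' by (simp add: eq pentaction_closed pentaction_rules)
    then show ?thesis using a b b' by (simp add: pentaction_closed pentaction_rules)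
  qed
  then show "lpow b = lpow b'" by (rule PiE_ext[OF PiE(4,9)])
qed (use b b' in \<open>simp_all add: pentaction_dots\<close>)

lemma pentaction_zero: "pentaction G (quint_zero G)"
  by (rule pentactionI) (simp_all add: quint_zero_def act_closed act_one one_act)

section \<open>The group of pentactions\<close>

lemma quint_add_sel:
  assumes "pentaction G b" "pentaction G b'" "a \<in> carrier G"
  shows "rpow (quint_add G b b') a = rpow b' (rpow b a)"
    "bpow (quint_add G b b') a = bpow b a \<otimes> bpow b' a"
  using assms by (simp_all add: quint_add_def pentaction_dots pentaction_closed)

lemma quint_act_sel:
  assumes "pentaction G b" "pentaction G b'" "a \<in> carrier G"
  shows "rpow (quint_act G b b') a = rpow b a"
    "bpow (quint_act G b b') a = rpow b' (bpow b a)"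
  using assms by (simp_all add: quint_act_def pentaction_dots)

lemma pentaction_add:
  assumes b: "pentaction G b" and b': "pentaction G b'"
  shows "pentaction G (quint_add G b b')"
proof -
  note s = pentaction_dots[OF b] pentaction_dots[OF b'] pentaction_closed[OF b]
    pentaction_closed[OF b'] pentaction_rules[OF b] pentaction_rules[OF b']
  show ?thesis
    unfolding quint_add_def
    by (rule pentactionI) (simp_all add: s act_closed act_mult act_act m_ac cong: restrict_cong)
qed

text \<open>Composing the crossed homomorphism \<open>bpow b\<close> with \<open>rpow b'\<close>
  yields another one, since \<open>rpow b'\<close> is additive and commutes with powers by elements
  of the group.\<close>

lemma pentaction_act:
  assumes b: "pentaction G b" and b': "pentaction G b'"
  shows "pentaction G (quint_act G b b')"
proof -
  note s = pentaction_dots[OF b] pentaction_dots[OF b'] pentaction_closed[OF b]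
    pentaction_closed[OF b'] pentaction_rules[OF b] pentaction_rules[OF b']
  show ?thesis
    unfolding quint_act_def
    by (rule pentactionI) (simp_all add: s act_closed)
qed

text \<open>The twist by \<open>ldot\<close> in the \<open>bpow\<close> of a sum is trivial on
  pentactions, so negating \<open>bpow\<close> pointwise is enough; the identity dots are
  kept.\<close>

definition quint_inv :: "'a quintuple \<Rightarrow> 'a quintuple" where
  "quint_inv b = b\<lparr>rpow := lpow b, lpow := rpow b, bpow := \<lambda>a\<in>carrier G. inv (bpow b a)\<rparr>"

lemma pentaction_inv:
  assumes b: "pentaction G b"
  shows "pentaction G (quint_inv b)"
proof -
  \<comment> \<open>This is clause 10 for the inverse: what acts trivially has an inverse acting
    trivially.\<close>
  have "a \<triangleleft> (inv (bpow b a')) = a" if "a \<in> carrier G" "a' \<in> carrier G" for a a'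
    using act_act_inv[of a "bpow b a'"] that
    by (simp add: pentaction_closed[OF b] pentaction_rules[OF b])
  then show ?thesis
    unfolding quint_inv_def
    by (intro pentactionI) (simp_all add: pentaction_PiE[OF b] pentaction_dots[OF b]
        pentaction_closed[OF b] pentaction_rules[OF b] act_closed inv_act inv_mult)
qed

lemma quint_add_inv:
  assumes b: "pentaction G b"
  shows "quint_add G (quint_inv b) b = quint_zero G"
  \<comment> \<open>\<open>quint_inv\<close> is unfolded only in the second pass, because the
    selector rules are instantiated for \<open>quint_inv b\<close> as a whole.\<close>
  by (rule pentaction_eqI[OF pentaction_add[OF pentaction_inv[OF b] b] pentaction_zero])
    (simp_all add: quint_add_sel[OF pentaction_inv[OF b] b] quint_zero_def,
      simp_all add: quint_inv_def pentaction_closed[OF b] pentaction_rules[OF b])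

lemma Pentact_sel:
  "b \<in> carrier (Pentact G) \<longleftrightarrow> pentaction G b"
  "b \<otimes>\<^bsub>Pentact G\<^esub> b' = quint_add G b b'"
  "\<one>\<^bsub>Pentact G\<^esub> = quint_zero G"
  "b \<triangleleft>\<^bsub>Pentact G\<^esub> b' = quint_act G b b'"
  by (simp_all add: Pentact_def)

lemmas pentaction_intros = pentaction_zero pentaction_add pentaction_act pentaction_inv

lemma quint_zero_sel:
  assumes "a \<in> carrier G"
  shows "rpow (quint_zero G) a = a" "bpow (quint_zero G) a = \<one>"
  using assms by (simp_all add: quint_zero_def)

lemma Pentact_group: "group (Pentact G)"
proof (rule groupI, unfold Pentact_sel)
  show "pentaction G (quint_zero G)" by (rule pentaction_zero)
next
  fix b b' assume "pentaction G b" "pentaction G b'"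
  then show "pentaction G (quint_add G b b')" by (rule pentaction_add)
next
  fix b b' b'' assume b: "pentaction G b" "pentaction G b'" "pentaction G b''"
  then show "quint_add G (quint_add G b b') b'' = quint_add G b (quint_add G b' b'')"
    by (intro pentaction_eqI pentaction_add)
      (simp_all add: quint_add_sel pentaction_add pentaction_closed m_assoc)
next
  fix b assume "pentaction G b"
  then show "quint_add G (quint_zero G) b = b"
    by (intro pentaction_eqI pentaction_add pentaction_zero)
      (simp_all add: quint_add_sel pentaction_zero quint_zero_sel pentaction_closed)
next
  fix b assume "pentaction G b"
  then show "\<exists>y\<in>carrier (Pentact G). quint_add G y b = quint_zero G"
    using quint_add_inv pentaction_inv Pentact_sel(1) by blast
qed

end


section \<open>Vanishing weak stabilizer\<close>

locale trivial_weak_stabilizer = reduced_group_with_action A for A (structure) +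
  assumes wStab: "wStab A = {\<one>}"
begin

text \<open>Each of the three families making up \<open>wStab\<close> yields one identity; the first
  does so directly, the other two (below) after cancelling a quotient.\<close>

lemma bpow_bpow:
  assumes "pentaction A b" "pentaction A b'" "a \<in> carrier A"
  shows "bpow b (bpow b' a) = \<one>"
proof -
  have "bpow b (bpow b' a) \<in> wStab A" using assms unfolding wStab_def by blast
  then show ?thesis using wStab by simp
qed

lemma eq_if_divide_eq_one: "\<lbrakk>x \<otimes> inv y = \<one>; x \<in> carrier A; y \<in> carrier A\<rbrakk> \<Longrightarrow> x = y"
  using right_cancel[of "inv y" x y] by simp

lemma bpow_rpow:
  assumes "pentaction A b" "pentaction A b'" "a \<in> carrier A"
  shows "bpow b (rpow b' a) = bpow b a"
proof -
  have "bpow b (rpow b' a) \<otimes> inv (bpow b a) = \<one>"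
    using wStab assms unfolding wStab_def by blast
  then show ?thesis using assms by (auto intro: eq_if_divide_eq_one pentaction_closed)
qed

lemma rpow_commute:
  assumes "pentaction A b" "pentaction A b'" "a \<in> carrier A"
  shows "rpow b (rpow b' a) = rpow b' (rpow b a)"
proof -
  have "rpow (quint_add A b b') a \<otimes> inv (rpow (quint_add A b' b) a) = \<one>"
    using wStab assms unfolding wStab_def by blast
  then have "rpow (quint_add A b b') a = rpow (quint_add A b' b) a"
    using assms by (auto intro: eq_if_divide_eq_one pentaction_closed pentaction_add)
  then show ?thesis using assms by (simp add: quint_add_sel)
qed

lemma quint_add_commute:
  assumes "pentaction A b" "pentaction A b'"
  shows "quint_add A b b' = quint_add A b' b"
  using assms
  by (intro pentaction_eqI)
    (simp_all add: pentaction_add quint_add_sel pentaction_closed m_comm rpow_commute)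

text \<open>Centrality of powers is commutativity of the addition, where \<open>wStab\<close> enters
  through \<open>rpow_commute\<close>. Reducedness holds because a power by \<open>b'\<close>
  depends only on \<open>rpow b'\<close>, and raising \<open>b'\<close> to \<open>b''\<close> leaves
  \<open>rpow\<close> unchanged.\<close>

lemma Pentact_reduced: "reduced_group_with_action (Pentact A)"
proof (intro reduced_group_with_action.intro group_with_action.intro Pentact_group
    group_with_action_axioms.intro reduced_group_with_action_axioms.intro, unfold Pentact_sel)
  fix b b' b'' assume b: "pentaction A b" "pentaction A b'" "pentaction A b''"
  note s = b pentaction_add pentaction_act quint_add_sel quint_act_sel pentaction_closed
  show "quint_act A (quint_add A b b') b'' = quint_add A (quint_act A b b'') (quint_act A b' b'')"
    by (rule pentaction_eqI) (simp_all add: s pentaction_rules(1))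
  show "quint_act A b (quint_add A b' b'') = quint_act A (quint_act A b b') b''"
    by (rule pentaction_eqI) (simp_all add: s)
  show "quint_act A b (quint_act A b' b'') = quint_act A b b'"
    by (rule pentaction_eqI) (simp_all add: s)
  show "quint_add A (quint_act A b b') b'' = quint_add A b'' (quint_act A b b')"
    by (rule quint_add_commute) (simp_all add: s)
next
  fix b assume b: "pentaction A b"
  then show "quint_act A b (quint_zero A) = b"
    by (intro pentaction_eqI pentaction_act pentaction_zero)
      (simp_all add: quint_act_sel pentaction_zero quint_zero_sel pentaction_closed)
qed (rule pentaction_act)

section \<open>The semidirect product of A and its pentactions\<close>

text \<open>A pair \<open>(a, b)\<close> stands for \<open>a + b\<close>. Its power by \<open>a' + b'\<close> is computed by acting first with
  \<open>a'\<close>, which sends \<open>b\<close> to \<open>bpow b a' + b\<close>, and then with \<open>b'\<close>.\<close>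

definition holomorph :: "('a \<times> 'a quintuple) gract" where
  "holomorph = \<lparr>carrier = carrier A \<times> carrier (Pentact A),
     mult = \<lambda>(a, b) (a', b'). (a \<otimes> a', quint_add A b b'),
     one = (\<one>, quint_zero A),
     act = \<lambda>(a, b) (a', b'). (rpow b' ((a \<triangleleft> a') \<otimes> bpow b a'), quint_act A b b')\<rparr>"

lemma holomorph_sel:
  "(a, b) \<in> carrier holomorph \<longleftrightarrow> a \<in> carrier A \<and> pentaction A b"
  "(a, b) \<otimes>\<^bsub>holomorph\<^esub> (a', b') = (a \<otimes> a', quint_add A b b')"
  "\<one>\<^bsub>holomorph\<^esub> = (\<one>, quint_zero A)"
  "(a, b) \<triangleleft>\<^bsub>holomorph\<^esub> (a', b') = (rpow b' ((a \<triangleleft> a') \<otimes> bpow b a'), quint_act A b b')"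
  by (simp_all add: holomorph_def Pentact_sel)

text \<open>Since the dots are the identity, the additive group is simply a direct product.\<close>

lemma holomorph_group: "group holomorph"
proof -
  interpret P: group "Pentact A" by (rule Pentact_group)
  note P = P.m_assoc P.l_one P.l_inv_ex
  show ?thesis
  proof (rule groupI)
    fix x assume "x \<in> carrier holomorph"
    then obtain a b where "x = (a, b)" "a \<in> carrier A" "pentaction A b"
      by (cases x) (simp add: holomorph_sel)
    then show "\<exists>y\<in>carrier holomorph. y \<otimes>\<^bsub>holomorph\<^esub> x = \<one>\<^bsub>holomorph\<^esub>"
      by (intro bexI[of _ "(inv a, quint_inv b)"])
        (simp_all add: holomorph_sel quint_add_inv pentaction_inv)
  qed (auto simp: holomorph_sel m_assoc pentaction_intros P[unfolded Pentact_sel])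
qed

text \<open>Handles the pentaction part of the reducedness axiom in \<open>holomorph\<close>:
  \<open>bpow_rpow\<close> strips \<open>rpow b''\<close>, the crossed rule splits the product, and
  \<open>bpow b' a'\<close> both acts trivially and is annihilated by \<open>bpow b\<close>.\<close>

lemma bpow_reduced:
  assumes "pentaction A b" "pentaction A b'" "pentaction A b''"
    and "a \<in> carrier A" "a' \<in> carrier A"
  shows "bpow b (rpow b'' ((a \<triangleleft> a') \<otimes> bpow b' a')) = bpow b a"
  using assms
  by (simp add: bpow_rpow bpow_bpow pentaction_rules(3,6,9) pentaction_closed act_closed)

text \<open>The counterpart of \<open>bpow_reduced\<close> for the component in \<open>A\<close>:
  here \<open>bpow b' a'\<close> drops out because it acts trivially.\<close>

lemma act_reduced_bpow:
  assumes "pentaction A b'" "pentaction A b''"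
    and "x \<in> carrier A" "a \<in> carrier A" "a' \<in> carrier A"
  shows "x \<triangleleft> rpow b'' ((a \<triangleleft> a') \<otimes> bpow b' a') = x \<triangleleft> a"
  using assms
  by (simp add: pentaction_rules(7,9) pentaction_closed act_closed act_act act_reduced)

lemma holomorph_reduced: "reduced_group_with_action holomorph"
proof -
  interpret P: reduced_group_with_action "Pentact A" by (rule Pentact_reduced)
  note P = P.act_mult P.act_act P.act_one P.act_reduced P.m_comm
  note P = P[unfolded Pentact_sel]
  note cl = act_closed pentaction_closed pentaction_intros
  show ?thesis
  proof (intro reduced_group_with_action.intro group_with_action.intro holomorph_group
      group_with_action_axioms.intro reduced_group_with_action_axioms.intro,
      unfold split_paired_all holomorph_sel, goal_cases)
    case 1 then show ?case by (simp add: cl)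
  next
    case 2 then show ?case
      by (simp add: cl P act_mult quint_add_sel pentaction_rules(1) m_ac)
  next
    \<comment> \<open>Composition of powers: the crossed rule expands \<open>bpow\<close> at a
      product, and \<open>rpow\<close> is moved past powers by elements of \<open>A\<close>.\<close>
    case 3 then show ?case
      by (simp add: cl P act_mult act_act quint_add_sel quint_act_sel pentaction_rules(1,3,4) m_ac)
  next
    case 4 then show ?case
      by (simp add: cl P act_one pentaction_one quint_zero_sel)
  next
    case 5 then show ?case by (simp add: cl P m_comm)
  next
    case 6 then show ?case
      by (simp add: cl P quint_act_sel bpow_reduced act_reduced_bpow)
  qed
qed

lemma Pentact_derived_action: "derived_action A (Pentact A) ldot bpow rpow"
proof -
  interpret P: reduced_group_with_action "Pentact A" by (rule Pentact_reduced)
  interpret H: reduced_group_with_action holomorph by (rule holomorph_reduced)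
  define i where "i a = (a, quint_zero A)" for a :: 'a
  define j where "j b = (\<one>, b)" for b :: "'a quintuple"
  have zero: "quint_add A (quint_zero A) b = b" "quint_add A b (quint_zero A) = b"
      "quint_act A (quint_zero A) b = quint_zero A" "quint_act A b (quint_zero A) = b"
    if "pentaction A b" for b
    using that P.l_one P.r_one P.one_act P.act_one unfolding Pentact_sel by auto
  have inv_j: "inv\<^bsub>holomorph\<^esub> (j b) = (\<one>, quint_inv b)" if "pentaction A b" for b
    using that
    by (intro H.inv_equality)
      (auto simp: j_def holomorph_sel pentaction_inv quint_add_inv)
  have add_inv: "quint_add A b (quint_inv b) = quint_zero A" if "pentaction A b" for b
    using that by (metis quint_add_inv quint_add_commute pentaction_inv)
  have "split_extension A (Pentact A) holomorph i snd j"
    unfolding split_extension_def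
    \<comment> \<open>The witness \<open>(\<one>, _)\<close> is the preimage that makes
      \<open>snd\<close> surjective.\<close>
    by (auto simp: P.reduced_group_with_action_axioms H.reduced_group_with_action_axioms
        reduced_group_with_action_axioms act_hom_def hom_def i_def j_def kernel_def inj_on_def
        holomorph_sel Pentact_sel pentaction_intros zero pentaction_one quint_zero_sel act_closed
        one_act image_iff
        intro!: bexI[of _ "(\<one>, _)"])
  moreover have "induces_action A (Pentact A) holomorph i j ldot bpow rpow"
    unfolding induces_action_def
    \<comment> \<open>\<open>inv_j\<close> has to rewrite the inverse before \<open>j\<close> is
      unfolded.\<close>
    by (auto simp: Pentact_sel inv_j)
      (auto simp: i_def j_def holomorph_sel zero add_inv pentaction_dots pentaction_closed
        pentaction_intros pentaction_one quint_zero_sel one_act act_one)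
  ultimately show ?thesis by (rule derived_action_if_split_extension)
qed

end


section \<open>The classifying homomorphism\<close>

locale split_extension_action =
  fixes A :: "('a, 'm) gract_scheme" and B :: "('b, 'n) gract_scheme"
    and E :: "('e, 'k) gract_scheme"
    and i :: "'a \<Rightarrow> 'e" and p :: "'e \<Rightarrow> 'b" and j :: "'b \<Rightarrow> 'e"
    and dot lexp rexp :: "'b \<Rightarrow> 'a \<Rightarrow> 'a"
  assumes split: "split_extension A B E i p j"
    and induced: "induces_action A B E i j dot lexp rexp"
begin

sublocale A: reduced_group_with_action A using split by (simp add: split_extension_def)
sublocale B: reduced_group_with_action B using split by (simp add: split_extension_def)
sublocale E: reduced_group_with_action E using split by (simp add: split_extension_def)
sublocale i: group_hom A E i
  using split by unfold_locales (auto simp: split_extension_def act_hom_def)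
sublocale j: group_hom B E j
  using split by unfold_locales (auto simp: split_extension_def act_hom_def)

lemma i_act: "\<lbrakk>x \<in> carrier A; y \<in> carrier A\<rbrakk> \<Longrightarrow> i (x \<triangleleft>\<^bsub>A\<^esub> y) = i x \<triangleleft>\<^bsub>E\<^esub> i y"
  using split by (simp add: split_extension_def act_hom_def)

lemma j_act: "\<lbrakk>x \<in> carrier B; y \<in> carrier B\<rbrakk> \<Longrightarrow> j (x \<triangleleft>\<^bsub>B\<^esub> y) = j x \<triangleleft>\<^bsub>E\<^esub> j y"
  using split by (simp add: split_extension_def act_hom_def)

text \<open>Oriented so that rewriting carries equations from \<open>A\<close> into
  \<open>E\<close>, where the induced operations become ordinary sums and powers.\<close>

lemma i_eq_iff: "\<lbrakk>x \<in> carrier A; y \<in> carrier A\<rbrakk> \<Longrightarrow> x = y \<longleftrightarrow> i x = i y"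
  using split by (auto simp: split_extension_def inj_on_def)

lemma induced_closed:
  assumes "b \<in> carrier B" "a \<in> carrier A"
  shows "dot b a \<in> carrier A" "lexp b a \<in> carrier A" "rexp b a \<in> carrier A"
  using induced assms by (auto simp: induces_action_def)

lemma i_induced:
  assumes "b \<in> carrier B" "a \<in> carrier A"
  shows "i (lexp b a) = (j b \<triangleleft>\<^bsub>E\<^esub> i a) \<otimes>\<^bsub>E\<^esub> inv\<^bsub>E\<^esub> (j b)" "i (rexp b a) = i a \<triangleleft>\<^bsub>E\<^esub> j b"
  using induced assms by (auto simp: induces_action_def)

text \<open>The dot is conjugation in \<open>E\<close>, which is commutative because it is
  reduced.\<close>

lemma dot_trivial:
  assumes "b \<in> carrier B" "a \<in> carrier A"
  shows "dot b a = a"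
proof -
  have "i (dot b a) = j b \<otimes>\<^bsub>E\<^esub> i a \<otimes>\<^bsub>E\<^esub> inv\<^bsub>E\<^esub> (j b)"
    using induced assms by (simp add: induces_action_def)
  also have "\<dots> = i a" using assms by (simp add: E.m_comm[of "j b"] E.m_assoc)
  finally show ?thesis using assms by (simp add: i_eq_iff induced_closed)
qed

definition classify :: "'b \<Rightarrow> 'a quintuple" where
  "classify = (\<lambda>b\<in>carrier B.
     \<lparr>ldot = \<lambda>a\<in>carrier A. a, rdot = \<lambda>a\<in>carrier A. a,
      rpow = \<lambda>a\<in>carrier A. rexp b a, lpow = \<lambda>a\<in>carrier A. rexp (inv\<^bsub>B\<^esub> b) a,
      bpow = \<lambda>a\<in>carrier A. lexp b a\<rparr>)"

lemma classify_sel: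
  assumes "b \<in> carrier B" "a \<in> carrier A"
  shows "ldot (classify b) a = a" "rpow (classify b) a = rexp b a"
    "bpow (classify b) a = lexp b a"
  using assms by (simp_all add: classify_def)

lemma E_inv_cancel: "\<lbrakk>x \<in> carrier E; y \<in> carrier E\<rbrakk> \<Longrightarrow> inv\<^bsub>E\<^esub> x \<otimes>\<^bsub>E\<^esub> (x \<otimes>\<^bsub>E\<^esub> y) = y"
  by (simp add: E.m_assoc[symmetric])

text \<open>Successive powers are the power by a sum, and sums commute in \<open>E\<close>.\<close>

lemma E_act_swap:
  assumes "x \<in> carrier E" "y \<in> carrier E" "z \<in> carrier E"
  shows "(x \<triangleleft>\<^bsub>E\<^esub> y) \<triangleleft>\<^bsub>E\<^esub> z = (x \<triangleleft>\<^bsub>E\<^esub> z) \<triangleleft>\<^bsub>E\<^esub> y"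
  using assms E.m_comm[of y z] by (metis E.act_act)

lemma E_act_displacement:
  assumes "x \<in> carrier E" "y \<in> carrier E" "z \<in> carrier E"
  shows "x \<triangleleft>\<^bsub>E\<^esub> ((y \<triangleleft>\<^bsub>E\<^esub> z) \<otimes>\<^bsub>E\<^esub> inv\<^bsub>E\<^esub> y) = x"
  using assms by (simp add: E.act_act E.act_reduced E.act_closed E.act_act_inv)

lemma classify_pentaction:
  assumes b: "b \<in> carrier B"
  shows "pentaction A (classify b)"
proof -
  have b': "inv\<^bsub>B\<^esub> b \<in> carrier B" using b by simp
  note s = induced_closed(2,3)[OF b] induced_closed(3)[OF b'] i_induced(1,2)[OF b]
    i_induced(2)[OF b'] A.act_closed i_act E.act_closed b
  \<comment> \<open>The conjunctions pair what \<open>rpow\<close> and \<open>lpow\<close> require: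
    \<open>lpow\<close> is the right power by the inverse of \<open>b\<close>. All goals are checked
    in \<open>E\<close> through \<open>i\<close>.\<close>
  have
    "rexp b (a \<otimes>\<^bsub>A\<^esub> a') = rexp b a \<otimes>\<^bsub>A\<^esub> rexp b a' \<and>
     rexp (inv\<^bsub>B\<^esub> b) (a \<otimes>\<^bsub>A\<^esub> a') = rexp (inv\<^bsub>B\<^esub> b) a \<otimes>\<^bsub>A\<^esub> rexp (inv\<^bsub>B\<^esub> b) a'"
    "lexp b (a \<otimes>\<^bsub>A\<^esub> a') = (lexp b a \<triangleleft>\<^bsub>A\<^esub> a') \<otimes>\<^bsub>A\<^esub> lexp b a'"
    "rexp b (a \<triangleleft>\<^bsub>A\<^esub> a') = rexp b a \<triangleleft>\<^bsub>A\<^esub> a' \<and>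
     rexp (inv\<^bsub>B\<^esub> b) (a \<triangleleft>\<^bsub>A\<^esub> a') = rexp (inv\<^bsub>B\<^esub> b) a \<triangleleft>\<^bsub>A\<^esub> a'"
    "lexp b (a \<triangleleft>\<^bsub>A\<^esub> a') = lexp b a"
    "a \<triangleleft>\<^bsub>A\<^esub> rexp b a' = a \<triangleleft>\<^bsub>A\<^esub> a' \<and> a \<triangleleft>\<^bsub>A\<^esub> rexp (inv\<^bsub>B\<^esub> b) a' = a \<triangleleft>\<^bsub>A\<^esub> a'"
    "a \<triangleleft>\<^bsub>A\<^esub> lexp b a' = a"
    "rexp (inv\<^bsub>B\<^esub> b) (rexp b a) = a \<and> rexp b (rexp (inv\<^bsub>B\<^esub> b) a) = a"
    if a: "a \<in> carrier A" "a' \<in> carrier A" for a a'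
    subgoal using a by (simp add: i_eq_iff s E.act_mult)
    subgoal using a by (simp add: i_eq_iff s E.act_mult E.act_act E.inv_act E.m_assoc
          E_inv_cancel)
    subgoal using a by (simp add: i_eq_iff s E_act_swap[of "i a" "i a'"])
    subgoal using a by (simp add: i_eq_iff s E.act_reduced)
    subgoal using a by (simp add: i_eq_iff s E.act_reduced)
    subgoal using a by (simp add: i_eq_iff s E_act_displacement)
    subgoal using a by (simp add: i_eq_iff s E.act_inv_act E.act_act_inv)
    done
  then show ?thesis
    using b b' unfolding classify_def
    by (intro A.pentactionI) (simp_all add: A.act_closed induced_closed)
qed

text \<open>For sums, \<open>bpow\<close> is a rearrangement in the commutative group
  \<open>E\<close>. For powers, \<open>rpow\<close> uses reducedness of \<open>E\<close>, and
  \<open>bpow\<close> exchanges the powers by \<open>i a\<close> and \<open>j b'\<close>.\<close>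

lemma classify_hom: "classify \<in> act_hom B (Pentact A)"
proof -
  have "classify (b \<otimes>\<^bsub>B\<^esub> b') = quint_add A (classify b) (classify b')"
    if b: "b \<in> carrier B" "b' \<in> carrier B" for b b'
    using b
    by (intro A.pentaction_eqI)
      (simp_all add: classify_pentaction A.pentaction_add A.quint_add_sel classify_sel
        induced_closed i_eq_iff i_induced E.act_act E.act_mult E.act_closed E.inv_mult E.m_ac
        E_act_swap[of _ "j b'" "j b"])
  moreover have "classify (b \<triangleleft>\<^bsub>B\<^esub> b') = quint_act A (classify b) (classify b')"
    if b: "b \<in> carrier B" "b' \<in> carrier B" for b b'
    using b
    by (intro A.pentaction_eqI)
      (simp_all add: classify_pentaction A.pentaction_act A.quint_act_sel classify_sel
        induced_closed i_eq_iff i_induced j_act B.act_closed E.act_closed E.act_mult E.act_reduced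
        E.inv_act E_act_swap[of "j b" "j b'"])
  ultimately show ?thesis
    by (simp add: act_hom_def hom_def A.Pentact_sel classify_pentaction)
qed

text \<open>A pentaction is determined by \<open>rpow\<close> and \<open>bpow\<close>, and the given
  action prescribes both.\<close>

lemma classify_unique:
  assumes hom: "\<phi> \<in> act_hom B (Pentact A)" and ext: "\<phi> \<in> extensional (carrier B)"
    and eq: "\<forall>b\<in>carrier B. \<forall>a\<in>carrier A. lexp b a = bpow (\<phi> b) a \<and> rexp b a = rpow (\<phi> b) a"
  shows "\<phi> = classify"
proof (rule extensionalityI[OF ext])
  show "classify \<in> extensional (carrier B)" by (simp add: classify_def)
  fix b assume b: "b \<in> carrier B"
  then have "pentaction A (\<phi> b)"
    using hom A.Pentact_sel(1) by (auto simp: act_hom_def hom_def)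
  then show "\<phi> b = classify b"
    using b eq by (intro A.pentaction_eqI) (auto simp: classify_pentaction classify_sel)
qed

end

lemma ex1_classifying_hom:
  fixes A :: "('a, 'm) gract_scheme" and B :: "('b, 'n) gract_scheme"
  assumes "derived_action A B dot lexp rexp"
  shows "\<exists>!\<phi>. \<phi> \<in> act_hom B (Pentact A) \<and> \<phi> \<in> extensional (carrier B) \<and>
    (\<forall>b\<in>carrier B. \<forall>a\<in>carrier A.
       dot b a = ldot (\<phi> b) a \<and> lexp b a = bpow (\<phi> b) a \<and> rexp b a = rpow (\<phi> b) a)"
proof -
  from assms obtain E :: "('a \<times> 'b) gract" and i p j where
    "split_extension A B E i p j" "induces_action A B E i j dot lexp rexp"
    unfolding derived_action_def by blast
  then interpret split_extension_action A B E i p j dot lexp rexp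
    by unfold_locales
  show ?thesis
  proof (rule ex1I[of _ classify])
    show "classify \<in> act_hom B (Pentact A) \<and> classify \<in> extensional (carrier B) \<and>
      (\<forall>b\<in>carrier B. \<forall>a\<in>carrier A. dot b a = ldot (classify b) a \<and>
         lexp b a = bpow (classify b) a \<and> rexp b a = rpow (classify b) a)"
      \<comment> \<open>The final \<open>simp\<close> settles extensionality, which needs
        \<open>classify\<close> unfolded.\<close>
      using classify_hom by (auto simp: classify_sel dot_trivial) (simp add: classify_def)
  qed (blast intro: classify_unique)
qed

theorem theorem4p2:
  fixes A :: "'a gract"
  assumes "reduced_group_with_action A"
    and "perfect A"
    and "wStab A = {\<one>\<^bsub>A\<^esub>}"
  shows "has_representable_action TYPE('a quintuple) TYPE('b) A \<and>
    action_representer TYPE('b) A (Pentact A) ldot bpow rpow"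
proof -
  interpret trivial_weak_stabilizer A
    using assms(1,3) by (simp add: trivial_weak_stabilizer_def trivial_weak_stabilizer_axioms_def)
  have "action_representer TYPE('b) A (Pentact A) ldot bpow rpow"
    unfolding action_representer_def
    using Pentact_reduced Pentact_derived_action ex1_classifying_hom by blast
  then show ?thesis unfolding has_representable_action_def by blast
qed

end
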